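(* Let $1\le q<\infty$, let $\alpha\in L^\infty(\mathcal I^n,\mu_p)$, and for every $j\in J$ let $q_j\in L^q(\mathcal I^n,\mu_p)$. If $\|\alpha\|_\infty<1$, then the associated fractal interpolation function $h^*$ belongs to $L^q(\mathcal I^n,\mu_p)$; that is, there is a unique $h^*\in L^q(\mathcal I^n,\mu_p)$ satisfying, for every $j\in J$ and $\mu_p$-almost every $y\in C_j$, $$h^*(y)=\alpha(y)\,h^*(\Theta_j^{-1}(y))+q_j(\Theta_j^{-1}(y)).$$
   Context: Let $n\ge 2$ and, for each $k\in\{1,\dots,n\}$, let $y_{k,0}<y_{k,1}<\cdots<y_{k,N_k}$ be real numbers. Put $I_k=[y_{k,0},y_{k,N_k}]$, $I_{k,j}=[y_{k,j-1},y_{k,j}]$ for $1\le j\le N_k$, and $\mathcal I^n=I_1\times\cdots\times I_n$. For each $k$ and $1\le j\le N_k$ let $v_{k,j}:I_k\to I_{k,j}$ be a homeomorphism with $|v_{k,j}(z)-v_{k,j}(z_* )|\le\gamma_{k,j}|z-z_*|$ for all $z,z_*\in I_k$, where $0<\gamma_{k,j}<1$, such that $v_{k,j}(y_{k,0})=y_{k,j-1}$, $v_{k,j}(y_{k,N_k})=y_{k,j}$ if $j$ is odd, and $v_{k,j}(y_{k,0})=y_{k,j}$, $v_{k,j}(y_{k,N_k})=y_{k,j-1}$ if $j$ is even. Let $J=\prod_{k=1}^n\{1,\dots,N_k\}$. For $j=(j_1,\dots,j_n)\in J$ put $C_j=\prod_{k=1}^n I_{k,j_k}$ and $\Theta_j:\mathcal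 I^n\to C_j$, $\Theta_j(y_1,\dots,y_n)=(v_{1,j_1}(y_1),\dots,v_{n,j_n}(y_n))$. Let $p=(p_j)_{j\in J}$ be a probability vector with all $p_j>0$, and let $\mu_p$ be the unique Borel probability measure on $\mathcal I^n$ with $\mu_p(B)=\sum_{j\in J}p_j\,\mu_p(\Theta_j^{-1}(B))$ for all Borel $B\subseteq\mathcal I^n$ (here $\Theta_j^{-1}(B)$ is the preimage). $L^q(\mathcal I^n,\mu_p)$ is the usual space of real-valued functions with norm $\|\cdot\|_q$, and $\|\cdot\|_\infty$ is the $\mu_p$-essential supremum norm. The fractal interpolation function (FIF) associated with $\alpha$ and $(q_j)_{j\in J}$ is the solution $h^*$ (fixed point of the associated Read–Bajraktarević operator) of the self-referential equation $h^*=\alpha\cdot(h^*\circ\Theta_j^{-1})+q_j\circ\Theta_j^{-1}$ on $C_j$, $j\in J$. *)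

theory Defs
  imports "HOL-Probability.Probability"
begin

text \<open>The coordinates \<open>k\<close> range over a finite type \<open>'n\<close>, and a multi-index is a function
  \<open>j :: 'n \<Rightarrow> nat\<close>.\<close>

definition axis_interval :: "('n \<Rightarrow> nat \<Rightarrow> real) \<Rightarrow> ('n \<Rightarrow> nat) \<Rightarrow> 'n \<Rightarrow> real set" where
  "axis_interval y N k = {y k 0..y k (N k)}"

definition axis_cell :: "('n \<Rightarrow> nat \<Rightarrow> real) \<Rightarrow> 'n \<Rightarrow> nat \<Rightarrow> real set" where
  "axis_cell y k j = {y k (j - 1)..y k j}"

definition domain_box :: "('n::finite \<Rightarrow> nat \<Rightarrow> real) \<Rightarrow> ('n \<Rightarrow> nat) \<Rightarrow> (real ^ 'n) set" where
  "domain_box y N = {x. \<forall>k. x $ k \<in> axis_interval y N k}"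

definition multi_indices :: "('n \<Rightarrow> nat) \<Rightarrow> ('n \<Rightarrow> nat) set" where
  "multi_indices N = {j. \<forall>k. j k \<in> {1..N k}}"

definition cell_box :: "('n::finite \<Rightarrow> nat \<Rightarrow> real) \<Rightarrow> ('n \<Rightarrow> nat) \<Rightarrow> (real ^ 'n) set" where
  "cell_box y j = {x. \<forall>k. x $ k \<in> axis_cell y k (j k)}"

definition Theta ::
  "('n::finite \<Rightarrow> nat \<Rightarrow> real \<Rightarrow> real) \<Rightarrow> ('n \<Rightarrow> nat) \<Rightarrow> real ^ 'n \<Rightarrow> real ^ 'n" where
  "Theta v j x = (\<chi> k. v k (j k) (x $ k))"

text \<open>Only meaningful on \<open>cell_box y j\<close>, the image of the domain under \<open>Theta v j\<close>.\<close>

definition Theta_inv ::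
  "('n::finite \<Rightarrow> nat \<Rightarrow> real) \<Rightarrow> ('n \<Rightarrow> nat) \<Rightarrow> ('n \<Rightarrow> nat \<Rightarrow> real \<Rightarrow> real) \<Rightarrow> ('n \<Rightarrow> nat)
    \<Rightarrow> real ^ 'n \<Rightarrow> real ^ 'n" where
  "Theta_inv y N v j = inv_into (domain_box y N) (Theta v j)"

text \<open>\<open>\<gamma> k j\<close> is a Lipschitz constant of the homeomorphism \<open>v k j\<close>; the values of
  \<open>v k j\<close> outside \<open>axis_interval y N k\<close> are irrelevant.\<close>

definition axis_system ::
  "('n \<Rightarrow> nat \<Rightarrow> real) \<Rightarrow> ('n \<Rightarrow> nat) \<Rightarrow> ('n \<Rightarrow> nat \<Rightarrow> real \<Rightarrow> real)
    \<Rightarrow> ('n \<Rightarrow> nat \<Rightarrow> real) \<Rightarrow> bool" where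
  "axis_system y N v \<gamma> \<longleftrightarrow>
    (\<forall>k. strict_mono_on {0..N k} (y k)) \<and>
    (\<forall>k. \<forall>j\<in>{1..N k}.
      (\<exists>w. homeomorphism (axis_interval y N k) (axis_cell y k j) (v k j) w) \<and>
      0 < \<gamma> k j \<and> \<gamma> k j < 1 \<and>
      (\<forall>z\<in>axis_interval y N k. \<forall>z'\<in>axis_interval y N k.
        \<bar>v k j z - v k j z'\<bar> \<le> \<gamma> k j * \<bar>z - z'\<bar>) \<and>
      (odd j \<longrightarrow> v k j (y k 0) = y k (j - 1) \<and> v k j (y k (N k)) = y k j) \<and>
      (even j \<longrightarrow> v k j (y k 0) = y k j \<and> v k j (y k (N k)) = y k (j - 1)))"

text \<open>By Hutchinson's theorem this equation has exactly one solution, so quantifying over all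
  invariant measures is the same as fixing that one.\<close>

definition invariant_measure ::
  "('n::finite \<Rightarrow> nat \<Rightarrow> real) \<Rightarrow> ('n \<Rightarrow> nat) \<Rightarrow> ('n \<Rightarrow> nat \<Rightarrow> real \<Rightarrow> real)
    \<Rightarrow> (('n \<Rightarrow> nat) \<Rightarrow> real) \<Rightarrow> (real ^ 'n) measure \<Rightarrow> bool" where
  "invariant_measure y N v p \<mu> \<longleftrightarrow>
    prob_space \<mu> \<and>
    space \<mu> = domain_box y N \<and>
    sets \<mu> = sets (restrict_space borel (domain_box y N)) \<and>
    (\<forall>B\<in>sets \<mu>. measure \<mu> B =
      (\<Sum>j\<in>multi_indices N. p j * measure \<mu> {x \<in> domain_box y N. Theta v j x \<in> B}))"

text \<open>Elements of the Lebesgue spaces are represented by functions; equality of elements is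
  equality almost everywhere.\<close>

definition Lq_space :: "real \<Rightarrow> 'a measure \<Rightarrow> ('a \<Rightarrow> real) set" where
  "Lq_space q M = {f \<in> borel_measurable M. integrable M (\<lambda>x. \<bar>f x\<bar> powr q)}"

definition Linf_norm :: "'a measure \<Rightarrow> ('a \<Rightarrow> real) \<Rightarrow> ereal" where
  "Linf_norm M f = esssup M (\<lambda>x. ereal \<bar>f x\<bar>)"

definition Linf_space :: "'a measure \<Rightarrow> ('a \<Rightarrow> real) set" where
  "Linf_space M = {f \<in> borel_measurable M. Linf_norm M f < \<infinity>}"

text \<open>Equivalently, \<open>h\<close> is almost everywhere a fixed point of the Read-Bajraktarevic operator.
  Adjacent cells overlap only in faces, which are null sets for the invariant measure.\<close>

definition is_FIF ::
  "('n::finite \<Rightarrow> nat \<Rightarrow> real) \<Rightarrow> ('n \<Rightarrow> nat) \<Rightarrow> ('n \<Rightarrow> nat \<Rightarrow> real \<Rightarrow> real)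
    \<Rightarrow> (real ^ 'n) measure \<Rightarrow> (real ^ 'n \<Rightarrow> real) \<Rightarrow> (('n \<Rightarrow> nat) \<Rightarrow> real ^ 'n \<Rightarrow> real)
    \<Rightarrow> (real ^ 'n \<Rightarrow> real) \<Rightarrow> bool" where
  "is_FIF y N v \<mu> \<alpha> Q h \<longleftrightarrow>
    (\<forall>j\<in>multi_indices N. AE x in \<mu>. x \<in> cell_box y j \<longrightarrow>
      h x = \<alpha> x * h (Theta_inv y N v j x) + Q j (Theta_inv y N v j x))"

end

theory Submission
  imports Defs
begin

text \<open>Send a point \<open>x\<close> of the cell \<open>C\<^sub>j\<close> to \<open>Theta_inv j x\<close>. The faces of the cells are null sets, so
  almost everywhere this defines one map \<open>S\<close>, and invariance of \<open>\<mu>\<close> under the branches of its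
  inverse makes \<open>S\<close> measure preserving. The equation becomes \<open>h = \<alpha> \<cdot> (h \<circ> S) + b\<close> with \<open>b\<close> in \<open>L\<^sup>q\<close>. It is solved by
  \<open>h = (\<Sum>n. (\<Prod>i<n. \<alpha> \<circ> S ^^ i) \<cdot> (b \<circ> S ^^ n))\<close>, and the difference \<open>d\<close> of two solutions satisfies
  \<open>\<integral>\<bar>d\<bar>\<^sup>q \<le> a\<^sup>q \<integral>\<bar>d\<bar>\<^sup>q\<close> with \<open>a < 1\<close>.\<close>

section \<open>Measure-preserving maps and their iterates\<close>

lemma AE_measure_preserving:
  assumes "S \<in> measurable M M" "distr M M S = M" "AE x in M. P x"
  shows "AE x in M. P (S x)"
  using AE_distrD[OF assms(1)] assms(2,3) by metis

lemma integral_measure_preserving: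
  fixes f :: "'a \<Rightarrow> real"
  assumes "S \<in> measurable M M" "distr M M S = M" "f \<in> borel_measurable M"
  shows "(\<integral>x. f (S x) \<partial>M) = (\<integral>x. f x \<partial>M)"
  using integral_distr[OF assms(1,3)] assms(2) by simp

lemma integrable_measure_preserving:
  fixes f :: "'a \<Rightarrow> real"
  assumes "S \<in> measurable M M" "distr M M S = M" "integrable M f"
  shows "integrable M (\<lambda>x. f (S x))"
  using integrable_distr[OF assms(1), of f] assms(2,3) by simp

lemma funpow_measure_preserving:
  assumes "S \<in> measurable M M" "distr M M S = M"
  shows "S ^^ n \<in> measurable M M \<and> distr M M (S ^^ n) = M"
proof (induction n)
  case 0
  have "distr M M (\<lambda>x. x) = M" by (rule distr_id)
  then show ?case by (simp add: id_def)
next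
  case (Suc n)
  then have 1: "S ^^ n \<in> measurable M M" and 2: "distr M M (S ^^ n) = M" by auto
  have "distr (distr M M (S ^^ n)) M S = distr M M (S \<circ> (S ^^ n))"
    using distr_distr[OF assms(1) 1] by simp
  then show ?case using 1 2 assms by (simp add: measurable_comp comp_def)
qed

section \<open>Series and differences in Lebesgue spaces\<close>

text \<open>By monotone convergence the extended-valued sum has the sum of the integrals as its
  integral. That is finite, so the sum can be infinite only on a null set.\<close>

lemma AE_summable_of_summable_integral:
  fixes f :: "nat \<Rightarrow> 'a \<Rightarrow> real"
  assumes int: "\<And>n. integrable M (f n)" and nn: "\<And>n x. f n x \<ge> 0"
    and sm: "summable (\<lambda>n. \<integral>x. f n x \<partial>M)"
  shows "AE x in M. summable (\<lambda>n. f n x)"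
proof -
  have [measurable]: "\<And>n. f n \<in> borel_measurable M" using int by auto
  have "(\<integral>\<^sup>+x. (\<Sum>n. ennreal (f n x)) \<partial>M) = (\<Sum>n. \<integral>\<^sup>+x. ennreal (f n x) \<partial>M)"
    by (rule nn_integral_suminf) auto
  also have "\<dots> = (\<Sum>n. ennreal (\<integral>x. f n x \<partial>M))"
    using int nn by (simp add: nn_integral_eq_integral)
  also have "\<dots> = ennreal (\<Sum>n. \<integral>x. f n x \<partial>M)"
    by (rule suminf_ennreal2) (use sm nn in auto)
  finally have "(\<integral>\<^sup>+x. (\<Sum>n. ennreal (f n x)) \<partial>M) \<noteq> \<infinity>" by simp
  then have "AE x in M. (\<Sum>n. ennreal (f n x)) \<noteq> \<infinity>"
    by (intro nn_integral_PInf_AE) auto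
  then show ?thesis
    by eventually_elim (use nn in \<open>auto intro!: summable_suminf_not_top\<close>)
qed

text \<open>With \<open>c = sqrt a\<close>, the splitting \<open>a ^ n = c ^ n * c ^ n\<close> bounds the series by
  \<open>sup\<^sub>n (c ^ n * \<bar>B n\<bar>) / (1 - c)\<close>, and the \<open>q\<close>-th power of the supremum by a sum; this replaces
  Minkowski's inequality and the completeness of the Lebesgue space.\<close>

lemma weighted_series_bound:
  fixes A B :: "nat \<Rightarrow> real"
  assumes c: "0 \<le> c" "c < 1" and q: "0 < q"
    and sm: "summable (\<lambda>n. \<bar>c ^ n * B n\<bar> powr q)"
    and A: "\<And>n. \<bar>A n\<bar> \<le> (c * c) ^ n"
  shows "summable (\<lambda>n. A n * B n)"
    and "\<bar>\<Sum>n. A n * B n\<bar> powr q \<le> (\<Sum>n. \<bar>c ^ n * B n\<bar> powr q) * (1 / (1 - c)) powr q"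
proof -
  define G where "G = (\<Sum>n. \<bar>c ^ n * B n\<bar> powr q)"
  have G0: "G \<ge> 0" unfolding G_def by (rule suminf_nonneg[OF sm]) simp
  have le: "\<bar>c ^ n * B n\<bar> \<le> G powr (1 / q)" for n
  proof -
    have "\<bar>c ^ n * B n\<bar> powr q \<le> G"
      unfolding G_def using sum_le_suminf[OF sm, of "{n}"] by simp
    then have "(\<bar>c ^ n * B n\<bar> powr q) powr (1 / q) \<le> G powr (1 / q)"
      using q by (intro powr_mono2) auto
    then show ?thesis using q by (simp add: powr_powr)
  qed
  have bd: "norm (A n * B n) \<le> G powr (1 / q) * c ^ n" for n
  proof -
    have "norm (A n * B n) \<le> (c * c) ^ n * \<bar>B n\<bar>"
      using A[of n] by (simp add: abs_mult mult_right_mono)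
    also have "\<dots> = c ^ n * \<bar>c ^ n * B n\<bar>"
      using c by (simp add: power_mult_distrib abs_mult)
    also have "\<dots> \<le> c ^ n * G powr (1 / q)"
      using le[of n] c by (intro mult_left_mono) auto
    finally show ?thesis by (simp add: mult.commute)
  qed
  have geo: "summable (\<lambda>n. G powr (1 / q) * c ^ n)"
    using c by (intro summable_mult summable_geometric) auto
  show "summable (\<lambda>n. A n * B n)"
    by (rule summable_comparison_test'[OF geo, of 0]) (use bd in auto)
  have "norm (\<Sum>n. A n * B n) \<le> (\<Sum>n. G powr (1 / q) * c ^ n)"
    by (rule norm_suminf_le[OF bd geo])
  also have "\<dots> = G powr (1 / q) * (1 / (1 - c))"
    using c by (subst suminf_mult) (auto simp: suminf_geometric summable_geometric)
  finally have "\<bar>\<Sum>n. A n * B n\<bar> powr q \<le> (G powr (1 / q) * (1 / (1 - c))) powr q"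
    using q by (intro powr_mono2) auto
  also have "\<dots> = G * (1 / (1 - c)) powr q"
    using q c G0 by (subst powr_mult) (auto simp: powr_powr)
  finally show "\<bar>\<Sum>n. A n * B n\<bar> powr q \<le> (\<Sum>n. \<bar>c ^ n * B n\<bar> powr q) * (1 / (1 - c)) powr q"
    by (simp add: G_def)
qed

text \<open>Bounding the difference by twice the larger absolute value costs only the factor
  \<open>2 powr q\<close>, and the power of a maximum is at most the sum of the powers. This crude
  estimate stands in for Minkowski's inequality.\<close>

lemma Lq_space_diff:
  assumes "f \<in> Lq_space q M" "g \<in> Lq_space q M" "0 \<le> q"
  shows "(\<lambda>x. f x - g x) \<in> Lq_space q M"
proof -
  have [measurable]: "f \<in> borel_measurable M" "g \<in> borel_measurable M"
    using assms by (auto simp: Lq_space_def)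
  have "integrable M (\<lambda>x. 2 powr q * (\<bar>f x\<bar> powr q + \<bar>g x\<bar> powr q))"
    using assms by (auto simp: Lq_space_def)
  then have "integrable M (\<lambda>x. \<bar>f x - g x\<bar> powr q)"
  proof (rule Bochner_Integration.integrable_bound)
    have "\<bar>f x - g x\<bar> powr q \<le> 2 powr q * (\<bar>f x\<bar> powr q + \<bar>g x\<bar> powr q)" for x
    proof -
      have "\<bar>f x - g x\<bar> powr q \<le> (2 * max \<bar>f x\<bar> \<bar>g x\<bar>) powr q"
        using assms by (intro powr_mono2) auto
      also have "\<dots> = 2 powr q * (max \<bar>f x\<bar> \<bar>g x\<bar>) powr q"
        by (subst powr_mult) auto
      also have "\<dots> \<le> 2 powr q * (\<bar>f x\<bar> powr q + \<bar>g x\<bar> powr q)"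
        by (intro mult_left_mono) (auto simp: max_def)
      finally show ?thesis .
    qed
    then show "AE x in M. norm (\<bar>f x - g x\<bar> powr q)
        \<le> norm (2 powr q * (\<bar>f x\<bar> powr q + \<bar>g x\<bar> powr q))"
      by (intro AE_I2) simp
  qed auto
  then show ?thesis by (simp add: Lq_space_def)
qed

section \<open>Affine equations along a measure-preserving map\<close>

text \<open>Subtracting the two equations removes \<open>b\<close>, so \<open>D\<close> is at most
  \<open>a powr q\<close> times \<open>D\<close> composed with \<open>S\<close>. Both functions have
  the same integral because \<open>S\<close> preserves \<open>M\<close>; as it is finite and the
  factor is below 1, it vanishes.\<close>

lemma affine_equation_unique:
  fixes S :: "'a \<Rightarrow> 'a" and \<alpha> :: "'a \<Rightarrow> real"
  assumes S: "S \<in> measurable M M" "distr M M S = M"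
    and a: "0 \<le> a" "a < 1" "AE x in M. \<bar>\<alpha> x\<bar> \<le> a" and q: "0 < q"
    and g: "g \<in> Lq_space q M" "AE x in M. g x = \<alpha> x * g (S x) + b x"
    and h: "h \<in> Lq_space q M" "AE x in M. h x = \<alpha> x * h (S x) + b x"
  shows "AE x in M. g x = h x"
proof -
  define D where "D = (\<lambda>x. \<bar>g x - h x\<bar> powr q)"
  have D: "integrable M D"
    using Lq_space_diff[OF g(1) h(1)] q by (simp add: Lq_space_def D_def)
  have DS: "integrable M (\<lambda>x. D (S x))"
    by (rule integrable_measure_preserving[OF S D])
  have "AE x in M. D x \<le> a powr q * D (S x)"
    using a(3) g(2) h(2)
  proof eventually_elim
    case (elim x)
    have "g x - h x = \<alpha> x * (g (S x) - h (S x))"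
      using elim by (simp add: algebra_simps)
    then have "D x = (\<bar>\<alpha> x\<bar> * \<bar>g (S x) - h (S x)\<bar>) powr q"
      by (simp add: D_def abs_mult)
    also have "\<dots> \<le> (a * \<bar>g (S x) - h (S x)\<bar>) powr q"
      using elim q by (intro powr_mono2 mult_right_mono) auto
    also have "\<dots> = a powr q * D (S x)"
      using a by (simp add: D_def powr_mult)
    finally show ?case .
  qed
  then have "(\<integral>x. D x \<partial>M) \<le> (\<integral>x. a powr q * D (S x) \<partial>M)"
    using D DS by (intro integral_mono_AE) auto
  also have "\<dots> = a powr q * (\<integral>x. D x \<partial>M)"
    using integral_measure_preserving[OF S, of D] D by simp
  finally have le: "(\<integral>x. D x \<partial>M) \<le> a powr q * (\<integral>x. D x \<partial>M)" .
  have "a powr q < 1"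
    using powr_less_mono2[of q a 1] a q by simp
  moreover have nn: "(\<integral>x. D x \<partial>M) \<ge> 0" by (simp add: D_def)
  ultimately have "(\<integral>x. D x \<partial>M) = 0"
    using le mult_strict_right_mono[of "a powr q" 1 "\<integral>x. D x \<partial>M"] by (cases "(\<integral>x. D x \<partial>M) = 0") auto
  then have "AE x in M. D x = 0"
    using integral_nonneg_eq_0_iff_AE[OF D] by (simp add: D_def)
  then show ?thesis by eventually_elim (simp add: D_def)
qed

lemma affine_equation_exists:
  fixes S :: "'a \<Rightarrow> 'a" and \<alpha> b :: "'a \<Rightarrow> real"
  assumes S: "S \<in> measurable M M" "distr M M S = M"
    and \<alpha>[measurable]: "\<alpha> \<in> borel_measurable M"
    and a: "0 < a" "a < 1" "AE x in M. \<bar>\<alpha> x\<bar> \<le> a" and q: "0 < q"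
    and b: "b \<in> Lq_space q M"
  obtains h where "h \<in> Lq_space q M" "AE x in M. h x = \<alpha> x * h (S x) + b x"
proof -
  define c where "c = sqrt a"
  have c: "0 < c" "c < 1" "c * c = a" using a by (auto simp: c_def)
  define A where "A = (\<lambda>n x. \<Prod>i<n. \<alpha> ((S ^^ i) x))"
  define B where "B = (\<lambda>n x. b ((S ^^ n) x))"
  define h where "h = (\<lambda>x. \<Sum>n. A n x * B n x)"
  \<comment> \<open>\<open>F\<close> carries only one of the two factors \<open>c ^ n\<close>. Since
    \<open>S ^^ n\<close> preserves \<open>M\<close>, its integrals decay like the powers of
    \<open>c powr q\<close>, which makes the sum over \<open>n\<close> integrable and finite almost
    everywhere. The other factor controls the series in
    \<open>weighted_series_bound\<close>.\<close>
  define F where "F = (\<lambda>n x. \<bar>c ^ n * B n x\<bar> powr q)"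
  have Sn[measurable]: "S ^^ n \<in> measurable M M" and dn: "distr M M (S ^^ n) = M" for n
    using funpow_measure_preserving[OF S] by auto
  have [measurable]: "b \<in> borel_measurable M" using b by (simp add: Lq_space_def)
  have [measurable]: "A n \<in> borel_measurable M" "B n \<in> borel_measurable M" for n
    unfolding A_def B_def by measurable
  have hm[measurable]: "h \<in> borel_measurable M" unfolding h_def by measurable
  have intb: "integrable M (\<lambda>x. \<bar>b x\<bar> powr q)" using b by (simp add: Lq_space_def)
  have Fe: "F n x = (c powr q) ^ n * (\<bar>b ((S ^^ n) x)\<bar> powr q)" for n x
    using c by (simp add: F_def B_def abs_mult powr_mult powr_realpow[symmetric] powr_powr mult.commute)
  have Fint: "integrable M (F n)" for n
    unfolding Fe using integrable_measure_preserving[OF Sn dn intb] by simp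
  have Fval: "(\<integral>x. F n x \<partial>M) = (c powr q) ^ n * (\<integral>x. \<bar>b x\<bar> powr q \<partial>M)" for n
    unfolding Fe
    using integral_measure_preserving[OF Sn dn, of "\<lambda>x. \<bar>b x\<bar> powr q"] by simp
  have cq: "c powr q < 1" using powr_less_mono2[of q c 1] c q by simp
  have Fsum: "summable (\<lambda>n. \<integral>x. F n x \<partial>M)"
    unfolding Fval using cq by (intro summable_mult2 summable_geometric) auto
  have F0: "F n x \<ge> 0" for n x by (simp add: F_def)
  have AEF: "AE x in M. summable (\<lambda>n. F n x)"
    by (rule AE_summable_of_summable_integral[OF Fint F0 Fsum])
  have Gint: "integrable M (\<lambda>x. \<Sum>n. F n x)"
    by (rule integrable_suminf[OF Fint]) (use AEF Fsum F0 in auto)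
  \<comment> \<open>For each \<open>n\<close> the exceptional set of \<open>a(3)\<close> is pulled
    back along \<open>S ^^ n\<close>; the union of these countably many null sets is still
    null.\<close>
  have AEa: "AE x in M. \<forall>n. \<bar>\<alpha> ((S ^^ n) x)\<bar> \<le> a"
    unfolding AE_all_countable using AE_measure_preserving[OF Sn dn a(3)] by blast
  have Abd: "\<bar>A n x\<bar> \<le> (c * c) ^ n" if "\<forall>n. \<bar>\<alpha> ((S ^^ n) x)\<bar> \<le> a" for n x
  proof -
    have "\<bar>A n x\<bar> = (\<Prod>i<n. \<bar>\<alpha> ((S ^^ i) x)\<bar>)" by (simp add: A_def abs_prod)
    also have "\<dots> \<le> (\<Prod>i<n. a)" using that by (intro prod_mono) auto
    finally show ?thesis using c by simp
  qed
  have AEs: "AE x in M. summable (\<lambda>n. A n x * B n x)"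
    using AEa AEF
  proof eventually_elim
    case (elim x)
    then show ?case
      by (intro weighted_series_bound(1)[of c q]) (use c q Abd in \<open>auto simp: F_def\<close>)
  qed
  have "AE x in M. \<bar>h x\<bar> powr q \<le> (\<Sum>n. F n x) * (1 / (1 - c)) powr q"
    using AEa AEF
  proof eventually_elim
    case (elim x)
    then show ?case
      unfolding h_def F_def
      by (intro weighted_series_bound(2)) (use c q Abd in \<open>auto simp: F_def\<close>)
  qed
  then have "AE x in M. norm (\<bar>h x\<bar> powr q) \<le> norm ((\<Sum>n. F n x) * (1 / (1 - c)) powr q)"
    by eventually_elim
       (simp only: real_norm_def abs_of_nonneg[OF powr_ge_zero] order_trans[OF _ abs_ge_self])
  then have hint: "integrable M (\<lambda>x. \<bar>h x\<bar> powr q)"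
    by (rule Bochner_Integration.integrable_bound[rotated 2]) (use Gint in auto)
  \<comment> \<open>Summability is used at two points: at \<open>x\<close> to split off the term of
    index 0, and at \<open>S x\<close> to pull \<open>\<alpha> x\<close> out of the remaining
    series.\<close>
  have "AE x in M. h x = \<alpha> x * h (S x) + b x"
    using AEs AE_measure_preserving[OF S AEs]
  proof eventually_elim
    case (elim x)
    \<comment> \<open>The factor of index 0 in the longer product is \<open>\<alpha> x\<close>, and
      \<open>S ^^ Suc i\<close> at \<open>x\<close> is \<open>S ^^ i\<close> at \<open>S x\<close>.
      So the tail of the series at \<open>x\<close> is the scaled series at
      \<open>S x\<close>.\<close>
    have step: "A (Suc n) x * B (Suc n) x = \<alpha> x * (A n (S x) * B n (S x))" for n
      unfolding A_def B_def
      by (simp add: prod.lessThan_Suc_shift funpow_swap1 del: prod.lessThan_Suc)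
    have "h x = A 0 x * B 0 x + (\<Sum>n. A (Suc n) x * B (Suc n) x)"
      unfolding h_def using suminf_split_head[OF elim(1)] by simp
    also have "(\<Sum>n. A (Suc n) x * B (Suc n) x) = \<alpha> x * h (S x)"
      unfolding h_def step using elim(2) by (rule suminf_mult)
    finally show ?case by (simp add: A_def B_def)
  qed
  with hint hm show ?thesis by (intro that[of h]) (auto simp: Lq_space_def)
qed

section \<open>Nodes and contractions on a single axis\<close>

lemma strict_mono_on_cell_index:
  fixes f :: "nat \<Rightarrow> real"
  assumes "strict_mono_on {0..n} f" "i \<le> n" "j \<in> {1..n}" "f (j - 1) \<le> f i" "f i \<le> f j"
  shows "i = j - 1 \<or> i = j"
proof -
  have "j - 1 \<le> i" "i \<le> j"
    using strict_mono_on_less_eq[OF assms(1), of "j - 1" i]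
      strict_mono_on_less_eq[OF assms(1), of i j] assms(2-) by auto
  then show ?thesis by auto
qed

context
  fixes y :: "'n::finite \<Rightarrow> nat \<Rightarrow> real"
    and N :: "'n \<Rightarrow> nat"
    and v :: "'n \<Rightarrow> nat \<Rightarrow> real \<Rightarrow> real"
    and \<gamma> :: "'n \<Rightarrow> nat \<Rightarrow> real"
  assumes sys: "axis_system y N v \<gamma>"
    and ne: "multi_indices N \<noteq> {}"
begin

lemma finite_multi_indices: "finite (multi_indices N)"
proof -
  have "multi_indices N = PiE UNIV (\<lambda>k. {1..N k})"
    by (auto simp: multi_indices_def PiE_def)
  then show ?thesis by (simp add: finite_PiE)
qed

lemma N_pos: "N k \<ge> 1"
proof -
  obtain j where "j \<in> multi_indices N" using ne by blast
  then have "j k \<in> {1..N k}" by (simp add: multi_indices_def)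
  then show ?thesis by simp
qed

lemma y_mono: "strict_mono_on {0..N k} (y k)"
  using sys by (simp add: axis_system_def)

lemma y_less: "i < j \<Longrightarrow> j \<le> N k \<Longrightarrow> y k i < y k j"
  using y_mono[of k] by (auto simp: strict_mono_on_def)

lemma y_le: "i \<le> j \<Longrightarrow> j \<le> N k \<Longrightarrow> y k i \<le> y k j"
  using y_less[of i j k] by (cases "i = j") auto

lemma axis_systemD:
  assumes "j \<in> {1..N k}"
  shows "\<exists>w. homeomorphism (axis_interval y N k) (axis_cell y k j) (v k j) w"
    "\<gamma> k j < 1"
    "\<And>z z'. z \<in> axis_interval y N k \<Longrightarrow> z' \<in> axis_interval y N k \<Longrightarrow>
      \<bar>v k j z - v k j z'\<bar> \<le> \<gamma> k j * \<bar>z - z'\<bar>"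
    "odd j \<Longrightarrow> v k j (y k 0) = y k (j - 1) \<and> v k j (y k (N k)) = y k j"
    "even j \<Longrightarrow> v k j (y k 0) = y k j \<and> v k j (y k (N k)) = y k (j - 1)"
  using bspec[OF spec[OF sys[unfolded axis_system_def, THEN conjunct2], of k] assms] by simp_all

lemma v_continuous:
  assumes "j \<in> {1..N k}"
  shows "continuous_on (axis_interval y N k) (v k j)"
  using axis_systemD(1)[OF assms] by (auto simp: homeomorphism_def)

lemma v_image:
  assumes "j \<in> {1..N k}"
  shows "v k j ` axis_interval y N k = axis_cell y k j"
  using axis_systemD(1)[OF assms] by (auto simp: homeomorphism_def)

lemma v_inj:
  assumes "j \<in> {1..N k}"
  shows "inj_on (v k j) (axis_interval y N k)"
proof -
  obtain w where "homeomorphism (axis_interval y N k) (axis_cell y k j) (v k j) w"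
    using axis_systemD(1)[OF assms] by blast
  then show ?thesis by (intro inj_on_inverseI[of _ w]) (simp add: homeomorphism_def)
qed

lemma end_in_interval: "y k 0 \<in> axis_interval y N k" "y k (N k) \<in> axis_interval y N k"
  using y_le[of 0 "N k" k] by (auto simp: axis_interval_def)

text \<open>With a single cell, \<open>v k 1\<close> would fix both ends of the interval, which a
  contraction constant below 1 forbids for distinct points. The second cell is what lets
  \<open>slab_null\<close> find a map that misses a given outer slab.\<close>

lemma N_ge_2: "N k \<ge> 2"
proof (rule ccontr)
  assume "\<not> N k \<ge> 2"
  then have N1: "N k = 1" using N_pos[of k] by simp
  have lt: "y k 0 < y k 1" using y_less[of 0 1 k] N1 by simp
  have one: "1 \<in> {1..N k}" using N1 by simp
  have "v k 1 (y k 0) = y k 0" "v k 1 (y k 1) = y k 1"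
    using axis_systemD(4)[OF one] N1 by auto
  moreover have "y k 0 \<in> axis_interval y N k" "y k 1 \<in> axis_interval y N k"
    using lt N1 by (auto simp: axis_interval_def)
  ultimately have "\<bar>y k 0 - y k 1\<bar> \<le> \<gamma> k 1 * \<bar>y k 0 - y k 1\<bar>" using axis_systemD(3)[OF one] by metis
  moreover have "\<gamma> k 1 * \<bar>y k 0 - y k 1\<bar> < 1 * \<bar>y k 0 - y k 1\<bar>"
    using lt axis_systemD(2)[OF one] by (intro mult_strict_right_mono) auto
  ultimately show False by simp
qed

text \<open>A node in a closed cell is one of its two ends, by strict monotonicity. Each end of the
  cell is the image of an end of the whole interval, so injectivity identifies \<open>z\<close>; the
  parity of \<open>j\<close> decides which end goes where.\<close>

lemma v_eq_node:
  assumes j: "j \<in> {1..N k}" and z: "z \<in> axis_interval y N k" and i: "i \<le> N k"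
    and eq: "v k j z = y k i"
  shows "z = y k 0 \<and> i = (if odd j then j - 1 else j) \<or>
    z = y k (N k) \<and> i = (if odd j then j else j - 1)"
proof -
  have "y k i \<in> axis_cell y k j" using v_image[OF j] z eq by force
  then have "i = j - 1 \<or> i = j"
    using strict_mono_on_cell_index[OF y_mono i j] by (auto simp: axis_cell_def)
  moreover have "z = y k 0" if "v k j z = v k j (y k 0)"
    using inj_onD[OF v_inj[OF j] that z end_in_interval(1)] .
  moreover have "z = y k (N k)" if "v k j z = v k j (y k (N k))"
    using inj_onD[OF v_inj[OF j] that z end_in_interval(2)] .
  ultimately show ?thesis
    using axis_systemD(4,5)[OF j] eq by (cases "odd j") auto
qed

section \<open>Boxes, cells and the product maps\<close>

lemma compact_domain_box: "compact (domain_box y N)"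
proof -
  have "domain_box y N = cbox (\<chi> k. y k 0) (\<chi> k. y k (N k))"
    by (auto simp: domain_box_def axis_interval_def mem_box_cart)
  then show ?thesis by simp
qed

lemma cell_box_subset: "j \<in> multi_indices N \<Longrightarrow> cell_box y j \<subseteq> domain_box y N"
proof
  fix x assume j: "j \<in> multi_indices N" and x: "x \<in> cell_box y j"
  show "x \<in> domain_box y N"
    unfolding domain_box_def axis_interval_def
  proof (intro CollectI allI)
    fix k
    have "j k \<in> {1..N k}" using j by (auto simp: multi_indices_def)
    then have "y k 0 \<le> y k (j k - 1)" "y k (j k) \<le> y k (N k)"
      by (auto intro!: y_le)
    moreover have "x $ k \<in> {y k (j k - 1)..y k (j k)}"
      using x by (simp add: cell_box_def axis_cell_def)
    ultimately show "x $ k \<in> {y k 0..y k (N k)}" by auto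
  qed
qed

lemma Theta_continuous:
  assumes "j \<in> multi_indices N"
  shows "continuous_on (domain_box y N) (Theta v j)"
  unfolding Theta_def
proof (intro continuous_on_vec_lambda)
  fix k
  have "j k \<in> {1..N k}" using assms by (auto simp: multi_indices_def)
  then show "continuous_on (domain_box y N) (\<lambda>x. v k (j k) (x $ k))"
    by (intro continuous_on_compose2[OF v_continuous] continuous_intros)
       (auto simp: domain_box_def)
qed

lemma Theta_inj:
  assumes "j \<in> multi_indices N"
  shows "inj_on (Theta v j) (domain_box y N)"
proof (rule inj_onI)
  fix x x' assume x: "x \<in> domain_box y N" "x' \<in> domain_box y N" and eq: "Theta v j x = Theta v j x'"
  show "x = x'"
  proof (rule vec_eq_iff[THEN iffD2], rule allI)
    fix k
    have "j k \<in> {1..N k}" using assms by (auto simp: multi_indices_def)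
    moreover have "v k (j k) (x $ k) = v k (j k) (x' $ k)"
      using arg_cong[OF eq, of "\<lambda>z. z $ k"] by (simp add: Theta_def)
    ultimately show "x $ k = x' $ k"
      using inj_onD[OF v_inj] x by (auto simp: domain_box_def)
  qed
qed

lemma Theta_image:
  assumes "j \<in> multi_indices N"
  shows "Theta v j ` domain_box y N = cell_box y j"
proof
  have jk: "j k \<in> {1..N k}" for k using assms by (auto simp: multi_indices_def)
  show "Theta v j ` domain_box y N \<subseteq> cell_box y j"
    using v_image[OF jk, symmetric] by (auto simp: Theta_def domain_box_def cell_box_def)
  show "cell_box y j \<subseteq> Theta v j ` domain_box y N"
  proof
    fix x assume "x \<in> cell_box y j"
    then have "\<forall>k. \<exists>z\<in>axis_interval y N k. v k (j k) z = x $ k"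
      using v_image[OF jk] by (simp add: cell_box_def) (metis imageE)
    then obtain z where "\<And>k. z k \<in> axis_interval y N k" "\<And>k. v k (j k) (z k) = x $ k"
      by metis
    then have "Theta v j (\<chi> k. z k) = x" "(\<chi> k. z k) \<in> domain_box y N"
      by (auto simp: Theta_def domain_box_def vec_eq_iff)
    then show "x \<in> Theta v j ` domain_box y N" by blast
  qed
qed

lemma Theta_inv_Theta:
  "j \<in> multi_indices N \<Longrightarrow> x \<in> domain_box y N \<Longrightarrow> Theta_inv y N v j (Theta v j x) = x"
  unfolding Theta_inv_def by (rule inv_into_f_f[OF Theta_inj])

lemma Theta_inv_in_domain:
  "j \<in> multi_indices N \<Longrightarrow> x \<in> cell_box y j \<Longrightarrow> Theta_inv y N v j x \<in> domain_box y N"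
  unfolding Theta_inv_def by (rule inv_into_into) (simp add: Theta_image)

text \<open>A continuous injection on a compact set has a continuous inverse on its image.\<close>

lemma Theta_inv_continuous:
  assumes "j \<in> multi_indices N"
  shows "continuous_on (cell_box y j) (Theta_inv y N v j)"
  using continuous_on_inv[OF Theta_continuous[OF assms] compact_domain_box, of "Theta_inv y N v j"]
  by (simp add: Theta_image[OF assms] Theta_inv_Theta[OF assms])

section \<open>Selection of a cell and the glued inverse\<close>

text \<open>The least index settles ties: a coordinate at a node shared by two cells is assigned to
  the lower one. The condition \<open>1 \<le> i\<close> puts the left end of an axis into cell 1,
  since cells are numbered from 1.\<close>

definition cell_index :: "real ^ 'n \<Rightarrow> 'n \<Rightarrow> nat" where
  "cell_index x = (\<lambda>k. LEAST i. 1 \<le> i \<and> x $ k \<le> y k i)"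

lemma cell_index:
  assumes "x \<in> domain_box y N"
  shows "cell_index x \<in> multi_indices N" "x \<in> cell_box y (cell_index x)"
proof -
  have "cell_index x k \<in> {1..N k} \<and> x $ k \<in> axis_cell y k (cell_index x k)" for k
  proof -
    let ?P = "\<lambda>i. 1 \<le> i \<and> x $ k \<le> y k i"
    have x: "y k 0 \<le> x $ k" "x $ k \<le> y k (N k)"
      using assms by (auto simp: domain_box_def axis_interval_def)
    have PN: "?P (N k)" using N_pos[of k] x by auto
    have P: "?P (cell_index x k)" and le: "cell_index x k \<le> N k"
      unfolding cell_index_def using LeastI[of ?P, OF PN] Least_le[of ?P, OF PN] by auto
    \<comment> \<open>If the chosen index exceeds 1, its predecessor fails the condition by
      minimality, which gives the lower bound; for index 1 the bound is the left end of the
      domain.\<close>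
    have "y k (cell_index x k - 1) \<le> x $ k"
    proof (cases "cell_index x k = 1")
      case False
      then have "cell_index x k - 1 < (LEAST i. ?P i)"
        using P by (simp add: cell_index_def)
      then have "\<not> ?P (cell_index x k - 1)" by (rule not_less_Least)
      then show ?thesis using False P by auto
    qed (use x in simp)
    then show ?thesis using P le by (auto simp: axis_cell_def)
  qed
  then show "cell_index x \<in> multi_indices N" "x \<in> cell_box y (cell_index x)"
    by (auto simp: multi_indices_def cell_box_def)
qed

text \<open>The node hyperplanes of the whole grid, outer boundary included. A point of the domain
  outside this set lies in exactly one cell.\<close>

definition faces :: "(real ^ 'n) set" where
  "faces = {x \<in> domain_box y N. \<exists>k. \<exists>i\<le>N k. x $ k = y k i}"

text \<open>Off the faces the lower end of the cell is strictly below the coordinate, so every index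
  smaller than \<open>j k\<close> fails the condition that defines \<open>cell_index\<close>, while
  \<open>j k\<close> satisfies it.\<close>

lemma cell_index_unique:
  assumes j: "j \<in> multi_indices N" and x: "x \<in> cell_box y j" "x \<notin> faces"
  shows "cell_index x = j"
proof
  fix k
  have jk: "1 \<le> j k" "j k \<le> N k" using j by (auto simp: multi_indices_def)
  have "x \<in> domain_box y N" using cell_box_subset[OF j] x by auto
  then have nf: "x $ k \<noteq> y k i" if "i \<le> N k" for i using x that by (auto simp: faces_def)
  have "y k (j k - 1) \<le> x $ k" "x $ k \<le> y k (j k)"
    using x by (auto simp: cell_box_def axis_cell_def)
  moreover have "x $ k \<noteq> y k (j k - 1)" using jk by (intro nf) simp
  ultimately have lt: "y k (j k - 1) < x $ k" "x $ k \<le> y k (j k)" by linarith+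
  show "cell_index x k = j k"
    unfolding cell_index_def
  proof (rule Least_equality)
    fix i assume i: "1 \<le> i \<and> x $ k \<le> y k i"
    show "j k \<le> i"
    proof (rule ccontr)
      assume "\<not> j k \<le> i"
      then have "y k i \<le> y k (j k - 1)" using jk by (intro y_le) auto
      then show False using i lt by linarith
    qed
  qed (use lt jk in auto)
qed

text \<open>This is the map \<open>S\<close> of the outline: the branches \<open>Theta_inv\<close>,
  glued by the choice of cell that \<open>cell_index\<close> makes.\<close>

definition shift :: "real ^ 'n \<Rightarrow> real ^ 'n" where
  "shift x = Theta_inv y N v (cell_index x) x"

lemma shift_in_domain: "x \<in> domain_box y N \<Longrightarrow> shift x \<in> domain_box y N"
  unfolding shift_def by (intro Theta_inv_in_domain cell_index)

lemma Theta_in_domain: "j \<in> multi_indices N \<Longrightarrow> x \<in> domain_box y N \<Longrightarrow> Theta v j x \<in> domain_box y N"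
  using Theta_image cell_box_subset by blast

lemma shift_Theta:
  assumes "j \<in> multi_indices N" "x \<in> domain_box y N" "Theta v j x \<notin> faces"
  shows "shift (Theta v j x) = x"
proof -
  have "cell_index (Theta v j x) = j"
    using assms Theta_image[of j] by (intro cell_index_unique) auto
  then show ?thesis using assms by (simp add: shift_def Theta_inv_Theta)
qed

section \<open>The invariant measure and its null faces\<close>

context
  fixes p :: "('n \<Rightarrow> nat) \<Rightarrow> real" and \<mu> :: "(real ^ 'n) measure"
  assumes p_pos: "\<And>j. j \<in> multi_indices N \<Longrightarrow> p j > 0"
    and p_sum: "(\<Sum>j\<in>multi_indices N. p j) = 1"
    and inv: "invariant_measure y N v p \<mu>"
begin

lemma finite_\<mu>: "finite_measure \<mu>" and space_\<mu>: "space \<mu> = domain_box y N"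
  and sets_\<mu>[measurable_cong]: "sets \<mu> = sets (restrict_space borel (domain_box y N))"
  and measure_\<mu>: "B \<in> sets \<mu> \<Longrightarrow> measure \<mu> B =
      (\<Sum>j\<in>multi_indices N. p j * measure \<mu> {x \<in> domain_box y N. Theta v j x \<in> B})"
  using inv by (auto simp: invariant_measure_def prob_space.finite_measure)

lemma emeasure_\<mu>: "emeasure \<mu> B = ennreal (measure \<mu> B)"
  by (rule finite_measure.emeasure_eq_measure[OF finite_\<mu>])

lemma measurable_\<mu>_codomain:
  assumes "f \<in> measurable M borel" "\<And>x. x \<in> space M \<Longrightarrow> f x \<in> domain_box y N"
  shows "f \<in> measurable M \<mu>"
proof -
  have "f \<in> measurable M (restrict_space borel (domain_box y N))"
    using assms by (intro measurable_restrict_space2) auto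
  then show ?thesis using measurable_cong_sets[OF refl sets_\<mu>] by blast
qed

lemma Theta_measurable:
  assumes "j \<in> multi_indices N"
  shows "Theta v j \<in> measurable \<mu> \<mu>"
proof (rule measurable_\<mu>_codomain)
  show "Theta v j \<in> borel_measurable \<mu>"
    using borel_measurable_continuous_on_restrict[OF Theta_continuous[OF assms]]
      measurable_cong_sets[OF sets_\<mu> refl] by blast
qed (simp add: space_\<mu> Theta_in_domain[OF assms])

lemma Theta_vimage_sets:
  assumes "j \<in> multi_indices N" "B \<in> sets \<mu>"
  shows "{x \<in> domain_box y N. Theta v j x \<in> B} \<in> sets \<mu>"
proof -
  have "{x \<in> domain_box y N. Theta v j x \<in> B} = Theta v j -` B \<inter> space \<mu>"
    by (auto simp: space_\<mu>)
  then show ?thesis using measurable_sets[OF Theta_measurable[OF assms(1)] assms(2)] by simp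
qed

lemma component_measurable[measurable]: "(\<lambda>x. x $ k) \<in> borel_measurable \<mu>"
proof -
  have "(\<lambda>x. x $ k) \<in> borel_measurable (restrict_space borel (domain_box y N))"
    by (intro borel_measurable_continuous_on_restrict continuous_intros)
  then show ?thesis using measurable_cong_sets[OF sets_\<mu> refl] by blast
qed

definition slab :: "'n \<Rightarrow> nat \<Rightarrow> (real ^ 'n) set" where
  "slab k i = {x \<in> domain_box y N. x $ k = y k i}"

lemma slab_sets[measurable]: "slab k i \<in> sets \<mu>"
proof -
  have "slab k i = {x \<in> space \<mu>. x $ k = y k i}" by (simp add: slab_def space_\<mu>)
  then show ?thesis by simp
qed

lemma measure_zero_subset: "A \<subseteq> B \<Longrightarrow> B \<in> sets \<mu> \<Longrightarrow> measure \<mu> B = 0 \<Longrightarrow> measure \<mu> A = 0"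
  using finite_measure.finite_measure_mono[OF finite_\<mu>, of A B]
  by (metis measure_nonneg order_antisym)

text \<open>The term of \<open>j0\<close> drops out of the invariance equation and every other term
  is bounded by its weight times \<open>measure \<mu> B\<close>. Hence
  \<open>measure \<mu> B\<close> is at most \<open>1 - p j0\<close> times itself, and
  \<open>p j0\<close> is positive.\<close>

lemma measure_zero_if_strict_loss:
  assumes B: "B \<in> sets \<mu>" and j0: "j0 \<in> multi_indices N"
    "measure \<mu> {x \<in> domain_box y N. Theta v j0 x \<in> B} = 0"
    and le: "\<And>j. j \<in> multi_indices N \<Longrightarrow>
      measure \<mu> {x \<in> domain_box y N. Theta v j x \<in> B} \<le> measure \<mu> B"
  shows "measure \<mu> B = 0"
proof -
  have "measure \<mu> B = (\<Sum>j\<in>multi_indices N - {j0}. p j * measure \<mu> {x \<in> domain_box y N. Theta v j x \<in> B})"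
    unfolding measure_\<mu>[OF B] using j0 by (subst sum.remove[OF finite_multi_indices j0(1)]) simp
  also have "\<dots> \<le> (\<Sum>j\<in>multi_indices N - {j0}. p j * measure \<mu> B)"
    using le p_pos by (intro sum_mono mult_left_mono) (auto intro: less_imp_le)
  also have "\<dots> = (1 - p j0) * measure \<mu> B"
    using sum.remove[OF finite_multi_indices j0(1), of p] p_sum
    by (simp add: sum_distrib_right[symmetric])
  finally have "p j0 * measure \<mu> B \<le> 0" by (simp add: algebra_simps)
  then show ?thesis
    using p_pos[OF j0(1)] measure_nonneg[of \<mu> B] by (simp add: mult_le_0_iff)
qed

lemma obtain_multi_index:
  assumes "i \<in> {1..N k}"
  obtains j where "j \<in> multi_indices N" "j k = i"
proof -
  obtain j where "j \<in> multi_indices N" using ne by blast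
  then have "j(k := i) \<in> multi_indices N" using assms by (simp add: multi_indices_def)
  then show ?thesis using that[of "j(k := i)"] by simp
qed

lemma Theta_in_slab:
  assumes j: "j \<in> multi_indices N" and x: "x \<in> domain_box y N" and i: "i \<le> N k"
    and "Theta v j x \<in> slab k i"
  shows "x \<in> slab k 0 \<and> i = (if odd (j k) then j k - 1 else j k) \<or>
    x \<in> slab k (N k) \<and> i = (if odd (j k) then j k else j k - 1)"
proof -
  have "j k \<in> {1..N k}" "x $ k \<in> axis_interval y N k" "v k (j k) (x $ k) = y k i"
    using assms by (auto simp: multi_indices_def domain_box_def slab_def Theta_def)
  from v_eq_node[OF this(1,2) i this(3)] show ?thesis using x by (simp add: slab_def)
qed

text \<open>A slab through an interior node is pulled back into the two outer slabs. The left outer slab is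
  pulled back into itself, and the right one into the outer slabs; each is missed by some \<open>Theta v j\<close>
  since every axis has at least two cells.\<close>

lemma slab_null:
  assumes i: "i \<le> N k"
  shows "measure \<mu> (slab k i) = 0"
proof -
  have mono: "measure \<mu> A \<le> measure \<mu> B" if "A \<subseteq> B" "B \<in> sets \<mu>" for A B
    using finite_measure.finite_measure_mono[OF finite_\<mu> that] .
  have N2: "N k \<ge> 2" by (rule N_ge_2)
  have jk: "j k \<in> {1..N k}" if "j \<in> multi_indices N" for j
    using that by (auto simp: multi_indices_def)
  have zero: "measure \<mu> (slab k 0) = 0"
  proof -
    obtain j0 where j0: "j0 \<in> multi_indices N" "j0 k = 2"
      using obtain_multi_index[of 2 k] N2 by auto
    have e: "{x \<in> domain_box y N. Theta v j0 x \<in> slab k 0} = {}"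
      using Theta_in_slab[OF j0(1), of _ 0 k] j0(2) by auto
    \<comment> \<open>Node 0 is reached only with \<open>j k = 1\<close>, whose map sends the left
      end to itself. All other alternatives in \<open>Theta_in_slab\<close> clash with the parity or
      with \<open>1 \<le> j k\<close>.\<close>
    have s: "{x \<in> domain_box y N. Theta v j x \<in> slab k 0} \<subseteq> slab k 0"
      if j: "j \<in> multi_indices N" for j
      using Theta_in_slab[OF j, of _ 0 k] jk[OF j] by (fastforce split: if_splits)
    show ?thesis
      by (rule measure_zero_if_strict_loss[OF _ j0(1)]) (simp_all add: e mono[OF s])
  qed
  have last: "measure \<mu> (slab k (N k)) = 0"
  proof -
    obtain j0 where j0: "j0 \<in> multi_indices N" "j0 k = 1"
      using obtain_multi_index[of 1 k] N2 by auto
    have e: "{x \<in> domain_box y N. Theta v j0 x \<in> slab k (N k)} = {}"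
      using Theta_in_slab[OF j0(1), of _ "N k" k] j0(2) N2 by auto
    have s: "{x \<in> domain_box y N. Theta v j x \<in> slab k (N k)} \<subseteq> slab k 0 \<union> slab k (N k)"
      if j: "j \<in> multi_indices N" for j
      using Theta_in_slab[OF j, of _ "N k" k] by auto
    \<comment> \<open>For even \<open>N k\<close> the last map sends the left end of the axis to the
      right end, so the left slab does occur in the pullback. It adds nothing because
      \<open>zero\<close> is already available, hence the order of the two claims.\<close>
    have "measure \<mu> (slab k 0 \<union> slab k (N k)) \<le> measure \<mu> (slab k (N k))"
      using measure_Un_le[of "slab k 0" \<mu> "slab k (N k)"] zero by simp
    then have le: "measure \<mu> {x \<in> domain_box y N. Theta v j x \<in> slab k (N k)} \<le> measure \<mu> (slab k (N k))"
      if "j \<in> multi_indices N" for j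
      using mono[OF s[OF that]] by simp
    show ?thesis
      by (rule measure_zero_if_strict_loss[OF _ j0(1)]) (simp_all add: e le)
  qed
  have null: "measure \<mu> (slab k 0 \<union> slab k (N k)) = 0"
    using measure_Un_le[of "slab k 0" \<mu> "slab k (N k)"] zero last
      measure_nonneg[of \<mu> "slab k 0 \<union> slab k (N k)"] by simp
  have "measure \<mu> {x \<in> domain_box y N. Theta v j x \<in> slab k i} = 0" if j: "j \<in> multi_indices N" for j
    by (rule measure_zero_subset[OF _ _ null]) (use Theta_in_slab[OF j _ i] in auto)
  then show ?thesis by (simp add: measure_\<mu>[OF slab_sets])
qed

lemma faces_sets: "faces \<in> sets \<mu>" and faces_null: "measure \<mu> faces = 0"
proof -
  have eq: "faces = (\<Union>k. \<Union>i\<in>{..N k}. slab k i)" by (auto simp: faces_def slab_def)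
  show m: "faces \<in> sets \<mu>" unfolding eq by auto
  have "slab k i \<in> null_sets \<mu>" if "i \<le> N k" for k i
    using slab_null[OF that] emeasure_\<mu>
    by (intro null_setsI) auto
  then have "(\<Union>k. \<Union>i\<in>{..N k}. slab k i) \<in> null_sets \<mu>"
    by (intro null_sets_UN') auto
  then show "measure \<mu> faces = 0" unfolding eq by (simp add: measure_def null_setsD1)
qed

lemma AE_not_faces: "AE x in \<mu>. x \<notin> faces"
  using faces_sets faces_null emeasure_\<mu>
  by (intro AE_not_in null_setsI) auto

section \<open>Measurability and invariance under the shift\<close>

lemma cell_index_sets: "{x \<in> domain_box y N. cell_index x = j} \<in> sets \<mu>"
proof -
  have "{x \<in> domain_box y N. cell_index x = j} = {x \<in> space \<mu>. \<forall>k. cell_index x k = j k}"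
    by (auto simp: space_\<mu>)
  also have "\<dots> \<in> sets \<mu>" unfolding cell_index_def by measurable
  finally show ?thesis .
qed

text \<open>The level sets of \<open>cell_index\<close> form a finite measurable partition of the
  domain. On each of them a function built from \<open>cell_index\<close> follows a single
  formula.\<close>

lemma measurable_by_cell_index:
  assumes "\<And>j. j \<in> multi_indices N \<Longrightarrow>
    f \<in> measurable (restrict_space \<mu> {x \<in> domain_box y N. cell_index x = j}) M"
  shows "f \<in> measurable \<mu> M"
proof (rule measurable_piecewise_restrict
    [of "(\<lambda>j. {x \<in> domain_box y N. cell_index x = j}) ` multi_indices N"])
  show "countable ((\<lambda>j. {x \<in> domain_box y N. cell_index x = j}) ` multi_indices N)"
    using finite_multi_indices by (intro countable_finite) auto
  show "space \<mu> \<subseteq> \<Union> ((\<lambda>j. {x \<in> domain_box y N. cell_index x = j}) ` multi_indices N)"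
    using cell_index(1) by (auto simp: space_\<mu>)
qed (use assms cell_index_sets in \<open>auto intro!: sets.Int\<close>)

lemma shift_measurable: "shift \<in> measurable \<mu> \<mu>"
proof (rule measurable_\<mu>_codomain)
  show "shift \<in> borel_measurable \<mu>"
  proof (rule measurable_by_cell_index)
    fix j assume j: "j \<in> multi_indices N"
    let ?D = "{x \<in> domain_box y N. cell_index x = j}"
    have "continuous_on ?D (Theta_inv y N v j)"
      by (rule continuous_on_subset[OF Theta_inv_continuous[OF j]]) (use cell_index(2) in auto)
    then have "Theta_inv y N v j \<in> borel_measurable (restrict_space borel ?D)"
      by (rule borel_measurable_continuous_on_restrict)
    \<comment> \<open>The level set lies inside the domain, so the two successive restrictions leave
      the trace of the Borel sets on it.\<close>
    moreover have "sets (restrict_space \<mu> ?D) = sets (restrict_space borel ?D)"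
    proof -
      have "sets (restrict_space \<mu> ?D) = sets (restrict_space (restrict_space borel (domain_box y N)) ?D)"
        by (rule sets_restrict_space_cong[OF sets_\<mu>])
      also have "\<dots> = sets (restrict_space borel ?D)"
        by (subst sets_restrict_restrict_space) (auto intro!: arg_cong[of _ _ "\<lambda>A. sets (restrict_space borel A)"])
      finally show ?thesis .
    qed
    ultimately have "Theta_inv y N v j \<in> borel_measurable (restrict_space \<mu> ?D)"
      using measurable_cong_sets by blast
    then show "shift \<in> borel_measurable (restrict_space \<mu> ?D)"
      by (subst measurable_cong[where g = "Theta_inv y N v j"])
         (auto simp: shift_def space_restrict_space)
  qed
qed (simp add: space_\<mu> shift_in_domain)

text \<open>For each \<open>j\<close>, pulling the \<open>shift\<close> preimage of \<open>B\<close>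
  back along \<open>Theta v j\<close> gives \<open>B\<close> again, up to points that
  \<open>Theta v j\<close> sends into a face, since elsewhere \<open>shift_Theta\<close> applies.
  Every term of the invariance equation then contains \<open>measure \<mu> B\<close>, and the
  weights add up to 1.\<close>

lemma shift_measure_preserving: "distr \<mu> \<mu> shift = \<mu>"
proof (rule measure_eqI)
  fix B assume "B \<in> sets (distr \<mu> \<mu> shift)"
  then have B: "B \<in> sets \<mu>" by simp
  let ?C = "shift -` B \<inter> space \<mu>"
  have C: "?C \<in> sets \<mu>" by (rule measurable_sets[OF shift_measurable B])
  have "measure \<mu> {x \<in> domain_box y N. Theta v j x \<in> ?C} = measure \<mu> B"
    if j: "j \<in> multi_indices N" for j
  proof (rule measure_eq_AE)
    \<comment> \<open>Invariance writes the measure of \<open>faces\<close>, which is 0, as a sum of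
      nonnegative terms. Each term vanishes, and as \<open>p j\<close> is positive, the preimage of
      the faces under \<open>Theta v j\<close> is null as well.\<close>
    have zero: "(\<Sum>j\<in>multi_indices N. p j * measure \<mu> {x \<in> domain_box y N. Theta v j x \<in> faces}) = 0"
      using measure_\<mu>[OF faces_sets] faces_null by simp
    have nonneg: "0 \<le> p j * measure \<mu> {x \<in> domain_box y N. Theta v j x \<in> faces}"
      if "j \<in> multi_indices N" for j
      using p_pos[OF that] by simp
    have "p j * measure \<mu> {x \<in> domain_box y N. Theta v j x \<in> faces} = 0"
      by (rule sum_nonneg_0[OF finite_multi_indices nonneg zero j])
    then have "{x \<in> domain_box y N. Theta v j x \<in> faces} \<in> null_sets \<mu>"
      using p_pos[OF j] Theta_vimage_sets[OF j faces_sets]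
        emeasure_\<mu>
      by (intro null_setsI) auto
    then have "AE x in \<mu>. x \<notin> {x \<in> domain_box y N. Theta v j x \<in> faces}" by (rule AE_not_in)
    with AE_space show "AE x in \<mu>. x \<in> {x \<in> domain_box y N. Theta v j x \<in> ?C} \<longleftrightarrow> x \<in> B"
    proof eventually_elim
      case (elim x)
      then show ?case using shift_Theta[OF j, of x] Theta_in_domain[OF j, of x] by (auto simp: space_\<mu>)
    qed
  qed (rule Theta_vimage_sets[OF j C], rule B)
  then have "measure \<mu> ?C = (\<Sum>j\<in>multi_indices N. p j) * measure \<mu> B"
    using measure_\<mu>[OF C] by (simp add: sum_distrib_right)
  then show "emeasure (distr \<mu> \<mu> shift) B = emeasure \<mu> B"
    using B p_sum emeasure_\<mu>
    by (simp add: emeasure_distr[OF shift_measurable])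
qed simp

section \<open>Interpolation functions as solutions of an affine equation\<close>

text \<open>From left to right, finitely many exceptional sets are joined and the equation is read
  at \<open>j = cell_index x\<close>. From right to left, a point off the null set of faces lies in
  the cell of \<open>j\<close> only if \<open>j\<close> is its \<open>cell_index\<close>.\<close>

lemma is_FIF_iff:
  "is_FIF y N v \<mu> \<alpha> Q h \<longleftrightarrow>
    (AE x in \<mu>. h x = \<alpha> x * h (shift x) + Q (cell_index x) (shift x))"
proof
  assume "is_FIF y N v \<mu> \<alpha> Q h"
  then have "AE x in \<mu>. \<forall>j\<in>multi_indices N. x \<in> cell_box y j \<longrightarrow>
      h x = \<alpha> x * h (Theta_inv y N v j x) + Q j (Theta_inv y N v j x)"
    unfolding is_FIF_def using finite_multi_indices by (simp add: AE_finite_all)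
  with AE_space show "AE x in \<mu>. h x = \<alpha> x * h (shift x) + Q (cell_index x) (shift x)"
  proof eventually_elim
    case (elim x)
    then show ?case using cell_index[of x] by (simp add: shift_def space_\<mu>)
  qed
next
  assume *: "AE x in \<mu>. h x = \<alpha> x * h (shift x) + Q (cell_index x) (shift x)"
  show "is_FIF y N v \<mu> \<alpha> Q h"
    unfolding is_FIF_def
  proof
    fix j assume j: "j \<in> multi_indices N"
    show "AE x in \<mu>. x \<in> cell_box y j \<longrightarrow>
      h x = \<alpha> x * h (Theta_inv y N v j x) + Q j (Theta_inv y N v j x)"
      using * AE_not_faces
    proof eventually_elim
      case (elim x)
      then show ?case using cell_index_unique[OF j, of x] by (auto simp: shift_def)
    qed
  qed
qed

text \<open>The selected index varies with the point, so the selected term is dominated by the sum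
  over all multi-indices. That sum is integrable because \<open>shift\<close> preserves
  \<open>\<mu>\<close> and the index set is finite.\<close>

lemma source_in_Lq:
  assumes Q: "\<And>j. j \<in> multi_indices N \<Longrightarrow> Q j \<in> Lq_space q \<mu>"
  shows "(\<lambda>x. Q (cell_index x) (shift x)) \<in> Lq_space q \<mu>"
proof -
  have Qm: "Q j \<in> borel_measurable \<mu>" and Qi: "integrable \<mu> (\<lambda>x. \<bar>Q j x\<bar> powr q)"
    if "j \<in> multi_indices N" for j
    using Q[OF that] by (auto simp: Lq_space_def)
  have m[measurable]: "(\<lambda>x. Q (cell_index x) (shift x)) \<in> borel_measurable \<mu>"
  proof (rule measurable_by_cell_index)
    fix j assume j: "j \<in> multi_indices N"
    have "(\<lambda>x. Q j (shift x)) \<in> borel_measurable \<mu>"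
      using measurable_compose[OF shift_measurable Qm[OF j]] .
    then show "(\<lambda>x. Q (cell_index x) (shift x))
        \<in> borel_measurable (restrict_space \<mu> {x \<in> domain_box y N. cell_index x = j})"
      by (subst measurable_cong[where g = "\<lambda>x. Q j (shift x)"])
         (auto simp: space_restrict_space intro: measurable_restrict_space1)
  qed
  have sum_int: "integrable \<mu> (\<lambda>x. \<Sum>j\<in>multi_indices N. \<bar>Q j (shift x)\<bar> powr q)"
    by (intro Bochner_Integration.integrable_sum
        integrable_measure_preserving[OF shift_measurable shift_measure_preserving] Qi)
  have bound: "AE x in \<mu>. norm (\<bar>Q (cell_index x) (shift x)\<bar> powr q)
      \<le> norm (\<Sum>j\<in>multi_indices N. \<bar>Q j (shift x)\<bar> powr q)"
  proof (rule AE_I2)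
    fix x assume "x \<in> space \<mu>"
    then have "\<bar>Q (cell_index x) (shift x)\<bar> powr q \<le> (\<Sum>j\<in>multi_indices N. \<bar>Q j (shift x)\<bar> powr q)"
      using cell_index(1)[of x] finite_multi_indices
      by (intro member_le_sum[where f = "\<lambda>j. \<bar>Q j (shift x)\<bar> powr q"]) (auto simp: space_\<mu>)
    then show "norm (\<bar>Q (cell_index x) (shift x)\<bar> powr q)
      \<le> norm (\<Sum>j\<in>multi_indices N. \<bar>Q j (shift x)\<bar> powr q)" by simp
  qed
  have "integrable \<mu> (\<lambda>x. \<bar>Q (cell_index x) (shift x)\<bar> powr q)"
    by (rule Bochner_Integration.integrable_bound[OF sum_int _ bound]) measurable
  then show ?thesis using m by (simp add: Lq_space_def)
qed

end

end

section \<open>The contraction constant and the conclusion\<close>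

lemma Linf_norm_less_oneD:
  assumes "Linf_norm M f < 1"
  obtains a :: real where "0 < a" "a < 1" "AE x in M. \<bar>f x\<bar> \<le> a"
proof -
  obtain r where r: "Linf_norm M f < ereal r" "ereal r < 1"
    using ereal_dense2[OF assms] by auto
  \<comment> \<open>The maximum with \<open>1 / 2\<close> makes the constant positive whatever the
    sign of \<open>r\<close>, as \<open>affine_equation_exists\<close> demands, and keeps it below
    1.\<close>
  have "AE x in M. \<bar>f x\<bar> \<le> max r (1 / 2)"
    using esssup_AE[where M = M and f = "\<lambda>x. ereal \<bar>f x\<bar>"]
  proof eventually_elim
    case (elim x)
    then have "ereal \<bar>f x\<bar> < ereal r" using r(1) unfolding Linf_norm_def by (rule le_less_trans)
    then show ?case by simp
  qed
  moreover have "r < 1" using r(2) by (simp add: one_ereal_def)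
  ultimately show ?thesis by (intro that[of "max r (1 / 2)"]) auto
qed

theorem theorem3p1:
  fixes y :: "'n::finite \<Rightarrow> nat \<Rightarrow> real"
    and N :: "'n \<Rightarrow> nat"
    and v :: "'n \<Rightarrow> nat \<Rightarrow> real \<Rightarrow> real"
    and \<gamma> :: "'n \<Rightarrow> nat \<Rightarrow> real"
    and p :: "('n \<Rightarrow> nat) \<Rightarrow> real"
    and \<mu> :: "(real ^ 'n) measure"
    and q :: real
    and \<alpha> :: "real ^ 'n \<Rightarrow> real"
    and Q :: "('n \<Rightarrow> nat) \<Rightarrow> real ^ 'n \<Rightarrow> real"
  assumes "CARD('n) \<ge> 2"
    and "axis_system y N v \<gamma>"
    and "\<And>j. j \<in> multi_indices N \<Longrightarrow> p j > 0"
    and "(\<Sum>j\<in>multi_indices N. p j) = 1"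
    and "invariant_measure y N v p \<mu>"
    and "1 \<le> q"
    and "\<alpha> \<in> Linf_space \<mu>"
    and "\<And>j. j \<in> multi_indices N \<Longrightarrow> Q j \<in> Lq_space q \<mu>"
    and "Linf_norm \<mu> \<alpha> < 1"
  shows "\<exists>h\<in>Lq_space q \<mu>. is_FIF y N v \<mu> \<alpha> Q h \<and>
           (\<forall>g\<in>Lq_space q \<mu>. is_FIF y N v \<mu> \<alpha> Q g \<longrightarrow> (AE x in \<mu>. g x = h x))"
proof -
  \<comment> \<open>An empty index set would make the weights sum to 0 instead of 1.\<close>
  have ne: "multi_indices N \<noteq> {}" using assms(4) by auto
  note ctx = assms(2) ne assms(3-5)
  \<comment> \<open>With these abbreviations \<open>is_FIF_iff\<close> turns the system over the
    cells into one affine equation along \<open>?S\<close> with source \<open>?b\<close>.\<close>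
  let ?S = "shift y N v" and ?b = "\<lambda>x. Q (cell_index y x) (shift y N v x)"
  have S: "?S \<in> measurable \<mu> \<mu>" "distr \<mu> \<mu> ?S = \<mu>"
    using shift_measurable[OF ctx] shift_measure_preserving[OF ctx] by auto
  have b: "?b \<in> Lq_space q \<mu>" using source_in_Lq[OF ctx assms(8)] .
  have \<alpha>: "\<alpha> \<in> borel_measurable \<mu>" using assms(7) by (simp add: Linf_space_def)
  have q: "0 < q" using assms(6) by simp
  note FIF = is_FIF_iff[OF ctx]
  obtain a where a: "0 < a" "a < 1" "AE x in \<mu>. \<bar>\<alpha> x\<bar> \<le> a"
    using Linf_norm_less_oneD[OF assms(9)] .
  obtain h where h: "h \<in> Lq_space q \<mu>" "AE x in \<mu>. h x = \<alpha> x * h (?S x) + ?b x"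
    using affine_equation_exists[OF S \<alpha> a q b] .
  have "AE x in \<mu>. g x = h x" if "g \<in> Lq_space q \<mu>" "is_FIF y N v \<mu> \<alpha> Q g" for g
    using affine_equation_unique[OF S less_imp_le[OF a(1)] a(2,3) q that(1)
        iffD1[OF FIF that(2)] h] .
  then show ?thesis using h(1) iffD2[OF FIF h(2)] by blast
qed

end
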